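(* Consider the status-updating semi-Markov decision process described in the context with a reliable channel, $p_s=1$, with $\hat\delta$ sufficiently large, and suppose $\frac{C(\boldsymbol a_1)}{L(\boldsymbol a_1)}\le\frac{C(\boldsymbol a_2)}{L(\boldsymbol a_2)}$. Let $$J(\Omega)=L(\boldsymbol a_1)+\tfrac12(\Omega-1)+\frac{\omega C(\boldsymbol a_1)}{\Omega}.$$ Then the optimal threshold $\Omega^*$ of the optimal update policy of the form "take $(0,0)$ in states $L(\boldsymbol a_1)\le s<\Omega$ and $\boldsymbol a_1$ in states $s\ge\Omega$" is $$\Omega^*=\arg\min\Big(J\big(\lfloor\sqrt{2\omega C(\boldsymbol a_1)}\rfloor\big),\,J\big(\lceil\sqrt{2\omega C(\boldsymbol a_1)}\rceil\big)\Big),$$ i.e. $\Omega^*$ is whichever of the two integers $\lfloor\sqrt{2\omega C(\boldsymbol a_1)}\rfloor$, $\lceil\sqrt{2\omega C(\boldsymbol a_1)}\rceil$ gives the smaller value of $J$, and the policy of this form on $\mathcal S^\dagger$ with $\Omega=\Omega^*$ attains the minimum average cost.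
   Context: Parameters: positive integers $T_u$ and $T_u'$ (sizes in packets of a status update before and after preprocessing), positive reals $l,v,f,\tau,\kappa,P$, and a weighting factor $\omega>0$. Put $T_p=\lceil T_u l v/(f\tau)\rceil$, $C_p=\kappa\tau f^3$, $C_u=P\tau$. The packet success probability is $p_s=1$. Actions: $\mathcal A=\{(0,0),(0,1),(1,1)\}$ (idle; transmit directly; preprocess then transmit). Durations in minislots: $L((0,0))=1$, $L((0,1))=T_u$, $L((1,1))=T_p+T_u'$. Energies: $C((0,0))=0$, $C((0,1))=T_uC_u$, $C((1,1))=T_pC_p+T_u'C_u$. States: the age of information (AoI) $s\in\mathcal S=\{1,2,\dots,\hat\delta\}$, where the upper limit $\hat\delta$ is finite but arbitrarily large. Only the states $\mathcal S^\dagger=\{\min\{T_u,T_p+T_u'\},\dots,\hat\delta\}$ matter (smaller states are non-recurrent). Transitions (deterministic since $p_s=1$): under $(0,0)$ the next state is $\min(s+1,\hat\delta)$; under $\boldsymbol a\in\{(0,1),(1,1)\}$ it is $\min(L(\boldsymbol a),\hat\delta)$. Cost of a time step: $R(s,\boldsymbol a)=\frac12(2s+L(\boldsymbol a)-1)L(\boldsymbol a)+\omega C(\boldsymbol a)$. The objective is to minimize, over stationary deterministic policies (attention is restricted to unichain policies), the average cost $\limsup_{T\to\infty}\mathbb E[\sum_{t=1}^T R(s(t),\boldsymbol a(t))]/\mathbb E[\sum_{t=1}^T L(\boldsymbol a(t))]$. $\boldsymbol a_1$ and $\boldsymbol a_2$ denote the two distinct elements of $\{(0,1),(1,1)\}$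 with $L(\boldsymbol a_1)=\min$ and $L(\boldsymbol a_2)=\max$ of $L$ over $\{(0,1),(1,1)\}$. Convention: $J(0)=+\infty$. *)

theory Defs
  imports "HOL-Probability.Probability"
begin

text \<open>Packet sizes of an update before and after preprocessing, the physical constants
  \<open>l, v, f, \<tau>, \<kappa>, P\<close>, and the weighting factor \<open>\<omega>\<close>.\<close>

record update_params =
  size_raw :: nat
  size_pre :: nat
  lpar :: real
  vpar :: real
  freq :: real
  tau :: real
  kappa :: real
  tx_power :: real
  weight :: real

definition valid_params :: "update_params \<Rightarrow> bool" where
  "valid_params p \<longleftrightarrow>
     size_raw p > 0 \<and> size_pre p > 0 \<and> lpar p > 0 \<and> vpar p > 0 \<and> freq p > 0 \<and>
     tau p > 0 \<and> kappa p > 0 \<and> tx_power p > 0 \<and> weight p > 0"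

text \<open>The actions \<open>(0,0)\<close>, \<open>(0,1)\<close> and \<open>(1,1)\<close>, in this order.\<close>

datatype action = Idle | Transmit | Preprocess

definition proc_time :: "update_params \<Rightarrow> nat" where
  "proc_time p = nat \<lceil>real (size_raw p) * lpar p * vpar p / (freq p * tau p)\<rceil>"

definition proc_energy :: "update_params \<Rightarrow> real" where
  "proc_energy p = kappa p * tau p * freq p ^ 3"

definition tx_energy :: "update_params \<Rightarrow> real" where
  "tx_energy p = tx_power p * tau p"

fun duration :: "update_params \<Rightarrow> action \<Rightarrow> nat" where
  "duration p Idle = 1"
| "duration p Transmit = size_raw p"
| "duration p Preprocess = proc_time p + size_pre p"

fun energy :: "update_params \<Rightarrow> action \<Rightarrow> real" where
  "energy p Idle = 0"
| "energy p Transmit = real (size_raw p) * tx_energy p"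
| "energy p Preprocess =
     real (proc_time p) * proc_energy p + real (size_pre p) * tx_energy p"

definition states :: "nat \<Rightarrow> nat set" where
  "states \<delta> = {1..\<delta>}"

definition relevant_states :: "update_params \<Rightarrow> nat \<Rightarrow> nat set" where
  "relevant_states p \<delta> = {min (size_raw p) (proc_time p + size_pre p)..\<delta>}"

text \<open>With packet success probability 1 every transmission succeeds, so the transition
  kernel is a function.\<close>

fun next_state :: "update_params \<Rightarrow> nat \<Rightarrow> nat \<Rightarrow> action \<Rightarrow> nat" where
  "next_state p \<delta> s Idle = min (s + 1) \<delta>"
| "next_state p \<delta> s Transmit = min (duration p Transmit) \<delta>"
| "next_state p \<delta> s Preprocess = min (duration p Preprocess) \<delta>"

definition step_cost :: "update_params \<Rightarrow> nat \<Rightarrow> action \<Rightarrow> real" where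
  "step_cost p s a =
     1 / 2 * (2 * real s + real (duration p a) - 1) * real (duration p a)
     + weight p * energy p a"

text \<open>A stationary deterministic policy is a function \<^typ>\<open>nat \<Rightarrow> action\<close>; its values outside
  \<^term>\<open>states \<delta>\<close> are irrelevant, since \<^term>\<open>states \<delta>\<close> is closed under transitions.\<close>

definition state_at :: "update_params \<Rightarrow> nat \<Rightarrow> (nat \<Rightarrow> action) \<Rightarrow> nat \<Rightarrow> nat \<Rightarrow> nat" where
  "state_at p \<delta> \<pi> s t = ((\<lambda>x. next_state p \<delta> x (\<pi> x)) ^^ t) s"

text \<open>In a finite chain with deterministic transitions a state is recurrent iff it is
  revisited at some positive time. The finite state space always contains a recurrent state,
  so unichain amounts to the recurrent states communicating.\<close>

definition recurrent :: "update_params \<Rightarrow> nat \<Rightarrow> (nat \<Rightarrow> action) \<Rightarrow> nat \<Rightarrow> bool" where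
  "recurrent p \<delta> \<pi> s \<longleftrightarrow> (\<exists>t>0. state_at p \<delta> \<pi> s t = s)"

definition unichain :: "update_params \<Rightarrow> nat \<Rightarrow> (nat \<Rightarrow> action) \<Rightarrow> bool" where
  "unichain p \<delta> \<pi> \<longleftrightarrow>
     (\<forall>s\<in>states \<delta>. \<forall>s'\<in>states \<delta>.
        recurrent p \<delta> \<pi> s \<longrightarrow> recurrent p \<delta> \<pi> s' \<longrightarrow> (\<exists>t. state_at p \<delta> \<pi> s t = s'))"

text \<open>The expectation is over the initial state, drawn from \<open>\<mu>\<close>, which is the only source of
  randomness. Time is counted from 0. The limit superior is taken in the extended reals, so
  that it always exists.\<close>

definition average_cost ::
    "update_params \<Rightarrow> nat \<Rightarrow> nat pmf \<Rightarrow> (nat \<Rightarrow> action) \<Rightarrow> ereal" where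
  "average_cost p \<delta> \<mu> \<pi> =
     limsup (\<lambda>T. ereal (
       measure_pmf.expectation \<mu>
         (\<lambda>s. \<Sum>t<T. step_cost p (state_at p \<delta> \<pi> s t) (\<pi> (state_at p \<delta> \<pi> s t))) /
       measure_pmf.expectation \<mu>
         (\<lambda>s. \<Sum>t<T. real (duration p (\<pi> (state_at p \<delta> \<pi> s t))))))"

definition optimal_policy :: "update_params \<Rightarrow> nat \<Rightarrow> (nat \<Rightarrow> action) \<Rightarrow> bool" where
  "optimal_policy p \<delta> \<pi> \<longleftrightarrow>
     unichain p \<delta> \<pi> \<and>
     (\<forall>\<pi>'. unichain p \<delta> \<pi>' \<longrightarrow>
        (\<forall>\<mu>. set_pmf \<mu> \<subseteq> states \<delta> \<longrightarrow> average_cost p \<delta> \<mu> \<pi> \<le> average_cost p \<delta> \<mu> \<pi>'))"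

text \<open>Only the relevant states are constrained; the actions in the smaller, non-recurrent
  states are arbitrary. A threshold below \<^term>\<open>duration p a\<close> is allowed and means that the
  policy never idles in a relevant state.\<close>

definition threshold_policy ::
    "update_params \<Rightarrow> nat \<Rightarrow> action \<Rightarrow> nat \<Rightarrow> (nat \<Rightarrow> action) \<Rightarrow> bool" where
  "threshold_policy p \<delta> a \<Omega> \<pi> \<longleftrightarrow>
     (\<forall>s\<in>relevant_states p \<delta>. \<pi> s = (if s < \<Omega> then Idle else a))"

definition optimal_threshold :: "update_params \<Rightarrow> nat \<Rightarrow> action \<Rightarrow> nat \<Rightarrow> bool" where
  "optimal_threshold p \<delta> a \<Omega> \<longleftrightarrow>
     (\<forall>\<pi>. threshold_policy p \<delta> a \<Omega> \<pi> \<longrightarrow> optimal_policy p \<delta> \<pi>)"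

definition J :: "update_params \<Rightarrow> action \<Rightarrow> nat \<Rightarrow> ereal" where
  "J p a \<Omega> =
     (if \<Omega> = 0 then \<infinity>
      else ereal (real (duration p a) + 1 / 2 * (real \<Omega> - 1)
                  + weight p * energy p a / real \<Omega>))"

end

theory Submission
  imports Defs
begin

text \<open>Fix a target average \<open>g\<close> and the potential \<open>h s = g s - s (s - 1) / 2\<close>. Against \<open>h\<close>, idling
  below \<open>\<delta>\<close> has reduced cost \<open>0\<close> and updating by \<open>a\<close> in state \<open>s\<close> has reduced cost
  \<open>s (J\<^sub>a s - g)\<close>. The energy-rate hypothesis gives \<open>J\<^sub>a s \<ge> J\<^bsub>a\<^sub>1\<^esub> s\<close> for both updates, and
  \<open>J\<^bsub>a\<^sub>1\<^esub>\<close> is minimized over \<open>s \<ge> L(a\<^sub>1)\<close> at \<open>max \<Omega>\<^sup>* L(a\<^sub>1)\<close>. With \<open>g\<close> this minimum, the reduced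
  costs in recurrent states are nonnegative for every policy, and zero along the threshold
  policy. Lowering or raising \<open>h\<close> by a constant in the transient states extends the sign
  conditions to all states, and telescoping bounds the average cost from every start.\<close>

section \<open>Average cost from a potential\<close>

lemma state_at_0 [simp]: "state_at p \<delta> \<pi> s 0 = s"
  by (simp add: state_at_def)

lemma state_at_Suc:
  "state_at p \<delta> \<pi> s (Suc t) =
     next_state p \<delta> (state_at p \<delta> \<pi> s t) (\<pi> (state_at p \<delta> \<pi> s t))"
  by (simp add: state_at_def)

lemma state_at_add: "state_at p \<delta> \<pi> s (m + n) = state_at p \<delta> \<pi> (state_at p \<delta> \<pi> s m) n"
  by (subst add.commute) (simp add: state_at_def funpow_add)

lemma state_at_Suc_shift:
  "state_at p \<delta> \<pi> s (Suc t) = state_at p \<delta> \<pi> (next_state p \<delta> s (\<pi> s)) t"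
  by (simp add: state_at_def funpow_Suc_right del: funpow.simps(2))

lemma duration_pos:
  assumes "valid_params p"
  shows "1 \<le> duration p a"
  using assms by (cases a) (auto simp: valid_params_def)

lemma next_state_in_states:
  assumes "valid_params p" "s \<in> states \<delta>"
  shows "next_state p \<delta> s a \<in> states \<delta>"
  using assms duration_pos[OF assms(1), of a] by (cases a) (auto simp: states_def)

lemma state_at_in_states:
  assumes "valid_params p" "s \<in> states \<delta>"
  shows "state_at p \<delta> \<pi> s t \<in> states \<delta>"
  by (induction t) (simp_all add: assms state_at_Suc next_state_in_states)

lemma finite_states [simp]: "finite (states \<delta>)"
  by (simp add: states_def)

lemma finite_abs_bound:
  fixes h :: "'a \<Rightarrow> real"
  assumes "finite A"
  obtains B where "\<And>x. x \<in> A \<Longrightarrow> \<bar>h x\<bar> \<le> B"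
proof -
  have "bdd_above ((\<lambda>x. \<bar>h x\<bar>) ` A)" using assms by simp
  then show thesis using that by (auto simp: bdd_above_def)
qed

abbreviation run_cost ::
    "update_params \<Rightarrow> nat \<Rightarrow> (nat \<Rightarrow> action) \<Rightarrow> nat \<Rightarrow> nat \<Rightarrow> real" where
  "run_cost p \<delta> \<pi> T s \<equiv>
     \<Sum>t<T. step_cost p (state_at p \<delta> \<pi> s t) (\<pi> (state_at p \<delta> \<pi> s t))"

abbreviation run_time ::
    "update_params \<Rightarrow> nat \<Rightarrow> (nat \<Rightarrow> action) \<Rightarrow> nat \<Rightarrow> nat \<Rightarrow> real" where
  "run_time p \<delta> \<pi> T s \<equiv> \<Sum>t<T. real (duration p (\<pi> (state_at p \<delta> \<pi> s t)))"

text \<open>Slack of the average-cost optimality equation with gain \<open>g\<close> and relative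
  value \<open>h\<close>.\<close>

definition reduced_cost ::
    "update_params \<Rightarrow> nat \<Rightarrow> real \<Rightarrow> (nat \<Rightarrow> real) \<Rightarrow> nat \<Rightarrow> action \<Rightarrow> real" where
  "reduced_cost p \<delta> g h s a =
     step_cost p s a - g * real (duration p a) + h (next_state p \<delta> s a) - h s"

lemma sum_reduced_cost:
  "(\<Sum>t<T. reduced_cost p \<delta> g h (state_at p \<delta> \<pi> s t) (\<pi> (state_at p \<delta> \<pi> s t))) =
     run_cost p \<delta> \<pi> T s - g * run_time p \<delta> \<pi> T s + h (state_at p \<delta> \<pi> s T) - h s"
  by (induction T) (simp_all add: reduced_cost_def state_at_Suc algebra_simps)

text \<open>Every action lasts at least one minislot; the growth in \<open>T\<close> makes bounded
  error terms vanish in the ratio.\<close>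

lemma run_time_expectation_ge:
  assumes "valid_params p" "set_pmf \<mu> \<subseteq> states \<delta>"
  shows "real T \<le> measure_pmf.expectation \<mu> (run_time p \<delta> \<pi> T)"
proof -
  have fin: "finite (set_pmf \<mu>)"
    using assms(2) finite_states by (rule finite_subset)
  have "(\<Sum>t<T. (1::real)) \<le> run_time p \<delta> \<pi> T s" for s
    by (intro sum_mono) (use duration_pos[OF assms(1)] in \<open>simp add: Suc_le_eq\<close>)
  then have "measure_pmf.expectation \<mu> (\<lambda>_. real T) \<le> measure_pmf.expectation \<mu> (run_time p \<delta> \<pi> T)"
    by (intro integral_mono integrable_measure_pmf_finite fin) auto
  then show ?thesis by simp
qed

lemma tendsto_plus_const_over_n: "(\<lambda>T. ereal (g + c / real T)) \<longlonglongrightarrow> ereal g"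
proof -
  have "(\<lambda>T. g + c / real T) \<longlonglongrightarrow> g + 0"
    by (intro tendsto_intros lim_const_over_n)
  then show ?thesis by simp
qed

text \<open>By telescoping, the cost falls short of \<open>g\<close> times the elapsed time by at
  most the oscillation of \<open>h\<close>, which is bounded since there are finitely many
  states.\<close>

lemma average_cost_ge:
  assumes valid: "valid_params p" and \<mu>: "set_pmf \<mu> \<subseteq> states \<delta>"
    and red: "\<And>s. s \<in> states \<delta> \<Longrightarrow> 0 \<le> reduced_cost p \<delta> g h s (\<pi> s)"
  shows "ereal g \<le> average_cost p \<delta> \<mu> \<pi>"
proof -
  obtain B where B: "\<And>s. s \<in> states \<delta> \<Longrightarrow> \<bar>h s\<bar> \<le> B"
    using finite_abs_bound[of "states \<delta>" h] by auto
  have fin: "finite (set_pmf \<mu>)"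
    using \<mu> finite_states by (rule finite_subset)
  obtain s\<^sub>0 where "s\<^sub>0 \<in> states \<delta>"
    using \<mu> set_pmf_not_empty[of \<mu>] by blast
  with B have B0: "0 \<le> B" by force
  have run: "g * run_time p \<delta> \<pi> T s - 2 * B \<le> run_cost p \<delta> \<pi> T s" if s: "s \<in> states \<delta>" for s T
  proof -
    have "0 \<le> (\<Sum>t<T. reduced_cost p \<delta> g h (state_at p \<delta> \<pi> s t) (\<pi> (state_at p \<delta> \<pi> s t)))"
      by (intro sum_nonneg red state_at_in_states valid s)
    then show ?thesis
      using B[OF s] B[OF state_at_in_states[OF valid s, of \<pi> T]]
      unfolding sum_reduced_cost by linarith
  qed
  have ratio: "g + (- 2 * B) / real T
      \<le> measure_pmf.expectation \<mu> (run_cost p \<delta> \<pi> T) / measure_pmf.expectation \<mu> (run_time p \<delta> \<pi> T)"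
    if T: "T > 0" for T
  proof -
    let ?L = "measure_pmf.expectation \<mu> (run_time p \<delta> \<pi> T)"
    have L: "real T \<le> ?L" by (rule run_time_expectation_ge[OF valid \<mu>])
    have "measure_pmf.expectation \<mu> (\<lambda>s. g * run_time p \<delta> \<pi> T s - 2 * B)
        \<le> measure_pmf.expectation \<mu> (run_cost p \<delta> \<pi> T)"
      using \<mu> run by (intro integral_mono_AE integrable_measure_pmf_finite fin)
        (auto simp: AE_measure_pmf_iff)
    also have "measure_pmf.expectation \<mu> (\<lambda>s. g * run_time p \<delta> \<pi> T s - 2 * B) = g * ?L - 2 * B"
      by (subst Bochner_Integration.integral_diff)
        (auto intro!: integrable_measure_pmf_finite fin)
    finally have "(g * ?L - 2 * B) / ?L \<le> measure_pmf.expectation \<mu> (run_cost p \<delta> \<pi> T) / ?L"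
      using L T by (intro divide_right_mono) auto
    moreover have "(g * ?L - 2 * B) / ?L = g - 2 * B / ?L"
      using L T by (simp add: diff_divide_distrib)
    moreover have "2 * B / ?L \<le> 2 * B / real T"
      using L T B0 by (intro divide_left_mono) auto
    ultimately show ?thesis by simp
  qed
  have "ereal g = limsup (\<lambda>T. ereal (g + (- 2 * B) / real T))"
    by (rule lim_imp_Limsup[symmetric, OF _ tendsto_plus_const_over_n]) simp
  also have "\<dots> \<le> average_cost p \<delta> \<mu> \<pi>"
    unfolding average_cost_def
    by (intro Limsup_mono eventually_mono[OF eventually_gt_at_top[of 0]]) (use ratio in simp)
  finally show ?thesis .
qed

lemma average_cost_le:
  assumes valid: "valid_params p" and \<mu>: "set_pmf \<mu> \<subseteq> states \<delta>"
    and red: "\<And>s. s \<in> states \<delta> \<Longrightarrow> reduced_cost p \<delta> g h s (\<pi> s) \<le> 0"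
  shows "average_cost p \<delta> \<mu> \<pi> \<le> ereal g"
proof -
  obtain B where B: "\<And>s. s \<in> states \<delta> \<Longrightarrow> \<bar>h s\<bar> \<le> B"
    using finite_abs_bound[of "states \<delta>" h] by auto
  have fin: "finite (set_pmf \<mu>)"
    using \<mu> finite_states by (rule finite_subset)
  obtain s\<^sub>0 where "s\<^sub>0 \<in> states \<delta>"
    using \<mu> set_pmf_not_empty[of \<mu>] by blast
  with B have B0: "0 \<le> B" by force
  have run: "run_cost p \<delta> \<pi> T s \<le> g * run_time p \<delta> \<pi> T s + 2 * B" if s: "s \<in> states \<delta>" for s T
  proof -
    have "(\<Sum>t<T. reduced_cost p \<delta> g h (state_at p \<delta> \<pi> s t) (\<pi> (state_at p \<delta> \<pi> s t))) \<le> 0"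
      by (intro sum_nonpos red state_at_in_states valid s)
    then show ?thesis
      using B[OF s] B[OF state_at_in_states[OF valid s, of \<pi> T]]
      unfolding sum_reduced_cost by linarith
  qed
  have ratio: "measure_pmf.expectation \<mu> (run_cost p \<delta> \<pi> T) / measure_pmf.expectation \<mu> (run_time p \<delta> \<pi> T)
      \<le> g + 2 * B / real T"
    if T: "T > 0" for T
  proof -
    let ?L = "measure_pmf.expectation \<mu> (run_time p \<delta> \<pi> T)"
    have L: "real T \<le> ?L" by (rule run_time_expectation_ge[OF valid \<mu>])
    have "measure_pmf.expectation \<mu> (run_cost p \<delta> \<pi> T)
        \<le> measure_pmf.expectation \<mu> (\<lambda>s. g * run_time p \<delta> \<pi> T s + 2 * B)"
      using \<mu> run by (intro integral_mono_AE integrable_measure_pmf_finite fin)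
        (auto simp: AE_measure_pmf_iff)
    also have "\<dots> = g * ?L + 2 * B"
      by (subst Bochner_Integration.integral_add)
        (auto intro!: integrable_measure_pmf_finite fin)
    finally have "measure_pmf.expectation \<mu> (run_cost p \<delta> \<pi> T) / ?L \<le> (g * ?L + 2 * B) / ?L"
      using L T by (intro divide_right_mono) auto
    moreover have "(g * ?L + 2 * B) / ?L = g + 2 * B / ?L"
      using L T by (simp add: add_divide_distrib)
    moreover have "2 * B / ?L \<le> 2 * B / real T"
      using L T B0 by (intro divide_left_mono) auto
    ultimately show ?thesis by simp
  qed
  have "average_cost p \<delta> \<mu> \<pi> \<le> limsup (\<lambda>T. ereal (g + 2 * B / real T))"
    unfolding average_cost_def
    by (intro Limsup_mono eventually_mono[OF eventually_gt_at_top[of 0]]) (use ratio in simp)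
  also have "\<dots> = ereal g"
    by (rule lim_imp_Limsup[OF _ tendsto_plus_const_over_n]) simp
  finally show ?thesis .
qed

section \<open>Unichain policies\<close>

text \<open>A recurrent \<open>s'\<close> passes through \<open>c\<close> and returns to itself, so
  \<open>c\<close> leads to \<open>s'\<close>, and every state leads to \<open>c\<close>.\<close>

lemma unichain_if_common_state:
  assumes reach: "\<And>s. s \<in> states \<delta> \<Longrightarrow> \<exists>t. state_at p \<delta> \<pi> s t = c"
  shows "unichain p \<delta> \<pi>"
  unfolding unichain_def
proof (intro ballI impI)
  fix s s' assume s: "s \<in> states \<delta>" and s': "s' \<in> states \<delta>" and "recurrent p \<delta> \<pi> s'"
  then obtain t where t: "t > 0" "state_at p \<delta> \<pi> s' t = s'"
    by (auto simp: recurrent_def)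
  have period: "state_at p \<delta> \<pi> s' (k * t) = s'" for k
    by (induction k) (simp_all add: state_at_add t)
  obtain m where m: "state_at p \<delta> \<pi> s m = c" using reach[OF s] by blast
  obtain n where n: "state_at p \<delta> \<pi> s' n = c" using reach[OF s'] by blast
  \<comment> \<open>A return time of \<open>s'\<close> that is no earlier than the visit to
    \<open>c\<close>.\<close>
  have "n \<le> n * t" using t(1) by simp
  then have "n * t = n + (n * t - n)" by simp
  then have "state_at p \<delta> \<pi> c (n * t - n) = s'"
    by (metis n period state_at_add)
  then have "state_at p \<delta> \<pi> s (m + (n * t - n)) = s'"
    by (simp add: state_at_add m)
  then show "\<exists>t. state_at p \<delta> \<pi> s t = s'" ..
qed

section \<open>Cost of a cycle\<close>

text \<open>\<open>J\<close> without its convention at 0. For \<open>n\<close> at least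
  \<open>duration p a\<close> and no capping, it is the average cost of idling from age
  \<open>duration p a\<close> to \<open>n\<close> and then updating, which takes \<open>n\<close>
  minislots.\<close>

definition cycle_cost :: "update_params \<Rightarrow> action \<Rightarrow> nat \<Rightarrow> real" where
  "cycle_cost p a n =
     real (duration p a) + 1 / 2 * (real n - 1) + weight p * energy p a / real n"

lemma J_eq_cycle_cost: "n > 0 \<Longrightarrow> J p a n = ereal (cycle_cost p a n)"
  by (simp add: J_def cycle_cost_def)

text \<open>The solution of \<open>h (s + 1) - h s = g - s\<close> with \<open>h 0 = 0\<close>;
  idling at age \<open>s\<close> costs \<open>s\<close>, so its reduced cost vanishes.\<close>

definition age_potential :: "real \<Rightarrow> nat \<Rightarrow> real" where
  "age_potential g s = g * real s - real s * (real s - 1) / 2"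

lemma next_state_update: "a \<noteq> Idle \<Longrightarrow> next_state p \<delta> s a = min (duration p a) \<delta>"
  by (cases a) auto

text \<open>All terms in the duration alone cancel, leaving the excess over \<open>g\<close>
  accumulated in a cycle of \<open>s\<close> minislots.\<close>

lemma age_potential_update:
  assumes "s > 0"
  shows "step_cost p s a - g * real (duration p a)
           + age_potential g (duration p a) - age_potential g s
         = real s * (cycle_cost p a s - g)"
  using assms by (simp add: step_cost_def age_potential_def cycle_cost_def field_simps)

lemma age_potential_idle:
  "step_cost p s Idle - g + age_potential g (s + 1) - age_potential g s = 0"
  by (simp add: step_cost_def age_potential_def field_simps)

text \<open>The difference of two cycle costs factors, so what matters is the order of
  \<open>m\<close> and \<open>n\<close> and whether \<open>n * m\<close> exceeds the square of the
  real minimizer.\<close>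

lemma cycle_cost_le_iff:
  assumes "m > 0" "n > 0"
  shows "cycle_cost p a m \<le> cycle_cost p a n \<longleftrightarrow>
    0 \<le> (real n - real m) * (real n * real m - 2 * weight p * energy p a)"
proof -
  have "cycle_cost p a n - cycle_cost p a m =
      (real n - real m) * (real n * real m - 2 * weight p * energy p a) / (2 * real n * real m)"
    using assms by (simp add: cycle_cost_def field_simps)
  then have "cycle_cost p a m \<le> cycle_cost p a n \<longleftrightarrow>
      0 \<le> (real n - real m) * (real n * real m - 2 * weight p * energy p a) / (2 * real n * real m)"
    by linarith
  also have "\<dots> \<longleftrightarrow> 0 \<le> (real n - real m) * (real n * real m - 2 * weight p * energy p a)"
    using assms by (subst pos_le_divide_eq) simp_all
  finally show ?thesis .
qed

lemma energy_pos:
  assumes "valid_params p" "a \<noteq> Idle"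
  shows "0 < energy p a"
  using assms
  by (cases a) (auto simp: valid_params_def tx_energy_def proc_energy_def intro!: add_nonneg_pos)

text \<open>The cycle cost decreases up to the square root and increases beyond it, so the better
  neighbouring integer is best among positive integers. If it lies below \<open>L\<close>, then
  \<open>L\<close> is already in the increasing range.\<close>

lemma cycle_cost_minimum:
  assumes valid: "valid_params p" and a: "a \<noteq> Idle" and L: "L > 0"
    and arg: "is_arg_min (J p a)
             (\<lambda>n. n \<in> {nat \<lfloor>sqrt (2 * weight p * energy p a)\<rfloor>,
                       nat \<lceil>sqrt (2 * weight p * energy p a)\<rceil>}) \<Omega>"
    and n: "L \<le> n"
  shows "cycle_cost p a (max \<Omega> L) \<le> cycle_cost p a n"
proof -
  define c where "c = 2 * weight p * energy p a"
  define x where "x = sqrt c"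
  define lo hi where "lo = nat \<lfloor>x\<rfloor>" and "hi = nat \<lceil>x\<rceil>"
  have "c > 0"
    using valid energy_pos[OF valid a] by (simp add: c_def valid_params_def)
  then have x: "x > 0" "x * x = c" by (simp_all add: x_def)
  have lo: "real lo \<le> x" and hi: "x \<le> real hi" and hi_lo: "hi \<le> lo + 1"
    using x by (auto simp: lo_def hi_def) linarith+
  have hi0: "hi > 0" using x hi by (cases hi) auto
  have \<Omega>: "\<Omega> = lo \<or> \<Omega> = hi"
    and min: "\<not> J p a lo < J p a \<Omega>" "\<not> J p a hi < J p a \<Omega>"
    using arg by (auto simp: is_arg_min_def lo_def hi_def x_def c_def)
  \<comment> \<open>Zero can arise only as the floor, where \<open>J\<close> is infinite and loses
    to its finite value at \<open>hi\<close>.\<close>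
  have \<Omega>0: "0 < \<Omega>"
    using min(2) J_eq_cycle_cost[OF hi0] by (cases \<Omega>) (auto simp: J_def)
  have above: "cycle_cost p a m \<le> cycle_cost p a n" if "x \<le> real m" "m \<le> n" for m
  proof -
    have "x * x \<le> real n * real m" using that x by (intro mult_mono) auto
    then show ?thesis using that x n L
      by (subst cycle_cost_le_iff) (auto simp: c_def[symmetric] intro!: mult_nonneg_nonneg)
  qed
  show "cycle_cost p a (max \<Omega> L) \<le> cycle_cost p a n"
  proof (cases "\<Omega> < L")
    case True
    \<comment> \<open>Since \<open>\<Omega>\<close> is at least \<open>lo\<close>,
      \<open>hi \<le> lo + 1 \<le> \<Omega> + 1 \<le> L\<close>.\<close>
    then have "hi \<le> L" using \<Omega> hi_lo by auto
    then have "x \<le> real L" using hi by linarith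
    then show ?thesis using above[of L] n True by simp
  next
    case False
    consider "hi \<le> n" | "n \<le> lo" using hi_lo by linarith
    then have "cycle_cost p a \<Omega> \<le> cycle_cost p a n"
    proof cases
      case 1
      have "cycle_cost p a \<Omega> \<le> cycle_cost p a hi"
        using min(2) hi0 \<Omega>0 by (simp add: J_eq_cycle_cost)
      then show ?thesis using above[OF hi 1] by linarith
    next
      case 2
      then have lo0: "lo > 0" using n L by simp
      \<comment> \<open>Both \<open>n\<close> and \<open>lo\<close> are at most \<open>x\<close>, so
        both factors in the comparison are nonpositive.\<close>
      have "real n * real lo \<le> x * x" using 2 lo x by (intro mult_mono) auto
      then have "cycle_cost p a lo \<le> cycle_cost p a n"
        using 2 lo0 n L x
        by (subst cycle_cost_le_iff) (auto simp: c_def[symmetric] intro!: mult_nonpos_nonpos)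
      moreover have "cycle_cost p a \<Omega> \<le> cycle_cost p a lo"
        using min(1) lo0 \<Omega>0 by (simp add: J_eq_cycle_cost)
      ultimately show ?thesis by linarith
    qed
    then show ?thesis using False by (simp add: max_absorb1)
  qed
qed

section \<open>Optimality of the threshold policy\<close>

text \<open>Naming the updates by their durations avoids case splits between \<open>Transmit\<close>
  and \<open>Preprocess\<close>.\<close>

locale ordered_updates =
  fixes p :: update_params and a\<^sub>1 a\<^sub>2 :: action
  assumes valid: "valid_params p"
    and action_cases: "a = Idle \<or> a = a\<^sub>1 \<or> a = a\<^sub>2"
    and update: "a\<^sub>1 \<noteq> Idle" "a\<^sub>2 \<noteq> Idle"
    and duration_le: "duration p a\<^sub>1 \<le> duration p a\<^sub>2"
    and relevant: "relevant_states p \<delta> = {duration p a\<^sub>1..\<delta>}"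
    and energy_rate_le: "energy p a\<^sub>1 / real (duration p a\<^sub>1) \<le> energy p a\<^sub>2 / real (duration p a\<^sub>2)"
begin

lemma duration_update: "a \<noteq> Idle \<Longrightarrow> duration p a\<^sub>1 \<le> duration p a \<and> duration p a \<le> duration p a\<^sub>2"
  using action_cases[of a] duration_le by auto

text \<open>Energy is rate times duration, and neither factor is larger for
  \<open>a\<^sub>1\<close>.\<close>

lemma energy_le: "energy p a\<^sub>1 \<le> energy p a\<^sub>2"
proof -
  have L: "0 < duration p a\<^sub>1" "0 < duration p a\<^sub>2"
    using duration_pos[OF valid] by (auto simp: Suc_le_eq)
  have "energy p a\<^sub>1 = energy p a\<^sub>1 / real (duration p a\<^sub>1) * real (duration p a\<^sub>1)"
    using L by simp
  also have "\<dots> \<le> energy p a\<^sub>2 / real (duration p a\<^sub>2) * real (duration p a\<^sub>2)"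
    using energy_rate_le duration_le energy_pos[OF valid update(2)] by (intro mult_mono) auto
  also have "\<dots> = energy p a\<^sub>2" using L by simp
  finally show ?thesis .
qed

text \<open>The cycle cost is monotone in duration and energy, so at every age the shorter update is
  at least as good.\<close>

lemma cycle_cost_update:
  assumes "a \<noteq> Idle"
  shows "cycle_cost p a\<^sub>1 n \<le> cycle_cost p a n"
proof -
  have "weight p * energy p a\<^sub>1 / real n \<le> weight p * energy p a\<^sub>2 / real n"
    using valid energy_le by (intro divide_right_mono mult_left_mono) (auto simp: valid_params_def)
  then have "cycle_cost p a\<^sub>1 n \<le> cycle_cost p a\<^sub>2 n"
    using duration_le unfolding cycle_cost_def by (intro add_mono) auto
  then show ?thesis using action_cases[of a] assms by auto
qed

lemma cycle_cost_nonneg: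
  assumes "a \<noteq> Idle" "n > 0"
  shows "0 \<le> cycle_cost p a n"
  using assms valid energy_pos[OF valid assms(1)]
  by (auto simp: cycle_cost_def valid_params_def intro!: add_nonneg_nonneg)

text \<open>One potential gives nonnegative reduced costs for every action in every state, which
  bounds all policies at once. The first bound on \<open>\<delta>\<close> excludes capped updates;
  the second handles idling at the top age.\<close>

lemma average_cost_lower_bound:
  assumes \<delta>: "duration p a\<^sub>2 \<le> \<delta>" "g \<le> real \<delta>" and g: "0 \<le> g"
    and min: "\<And>s. duration p a\<^sub>1 \<le> s \<Longrightarrow> g \<le> cycle_cost p a\<^sub>1 s"
    and \<mu>: "set_pmf \<mu> \<subseteq> states \<delta>"
  shows "ereal g \<le> average_cost p \<delta> \<mu> \<pi>"
proof -
  \<comment> \<open>Below \<open>duration p a\<^sub>1\<close> the cycle cost may be less than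
    \<open>g\<close>, but as it is nonnegative, the deficit is at most \<open>s * g \<le> M\<close>.
    An update leaves these ages and so regains \<open>M\<close>.\<close>
  define M where "M = g * real (duration p a\<^sub>1)"
  define h where "h s = age_potential g s - (if s < duration p a\<^sub>1 then M else 0)" for s
  have M: "0 \<le> M" using g by (simp add: M_def)
  have "0 \<le> reduced_cost p \<delta> g h s a" if s: "s \<in> states \<delta>" for s a
  proof (cases "a = Idle")
    case True
    show ?thesis
    proof (cases "s < \<delta>")
      case True
      then show ?thesis using \<open>a = Idle\<close> M age_potential_idle[of p s g]
        by (auto simp: reduced_cost_def h_def)
    next
      case False
      \<comment> \<open>Idling at age \<open>\<delta>\<close> keeps the age, so the reduced cost is
        \<open>\<delta> - g\<close>.\<close>
      then show ?thesis using \<open>a = Idle\<close> s \<delta> by (auto simp: reduced_cost_def states_def step_cost_def)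
    qed
  next
    case a: False
    have s0: "s > 0" using s by (simp add: states_def)
    have red: "reduced_cost p \<delta> g h s a =
        real s * (cycle_cost p a s - g) + (if s < duration p a\<^sub>1 then M else 0)"
      using a \<delta> duration_update[OF a] age_potential_update[OF s0, of p a g]
      by (simp add: reduced_cost_def h_def next_state_update min_absorb1)
    show ?thesis
    proof (cases "s < duration p a\<^sub>1")
      case True
      then have "real s * g \<le> M" using g by (simp add: M_def mult.commute mult_left_mono)
      moreover have "0 \<le> real s * cycle_cost p a s" using cycle_cost_nonneg[OF a s0] by simp
      ultimately show ?thesis using True by (simp add: red algebra_simps)
    next
      case False
      then have "g \<le> cycle_cost p a s" using min[of s] cycle_cost_update[OF a, of s] by linarith
      then show ?thesis using False by (simp add: red)
    qed
  qed
  then show ?thesis using average_cost_ge[OF valid \<mu>, of g h \<pi>] by simp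
qed

text \<open>\<open>N\<close> is the age at which the recurrent cycle updates: the cycle starts at
  age \<open>duration p a\<^sub>1\<close>, so a smaller threshold acts like this one.\<close>

context
  fixes \<delta> \<Omega> N :: nat and \<pi> :: "nat \<Rightarrow> action"
  assumes \<delta>: "duration p a\<^sub>2 \<le> \<delta>" "\<Omega> \<le> \<delta>"
    and threshold: "threshold_policy p \<delta> a\<^sub>1 \<Omega> \<pi>"
  defines "N \<equiv> max \<Omega> (duration p a\<^sub>1)"
begin

lemma N_bounds: "duration p a\<^sub>1 \<le> N" "N \<le> \<delta>"
  using \<delta> duration_le by (auto simp: N_def)

lemma threshold_idle: "duration p a\<^sub>1 \<le> s \<Longrightarrow> s < N \<Longrightarrow> \<pi> s = Idle"
  using threshold N_bounds by (auto simp: threshold_policy_def relevant N_def)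

lemma threshold_update: "N \<le> s \<Longrightarrow> s \<le> \<delta> \<Longrightarrow> \<pi> s = a\<^sub>1"
  using threshold by (auto simp: threshold_policy_def relevant N_def)

text \<open>With the cost of the cycle as gain, the reduced costs on it vanish. In the transient
  states the potential is raised to absorb positive ones.\<close>

lemma threshold_average_cost:
  assumes \<mu>: "set_pmf \<mu> \<subseteq> states \<delta>"
  shows "average_cost p \<delta> \<mu> \<pi> \<le> ereal (cycle_cost p a\<^sub>1 N)"
proof -
  define g where "g = cycle_cost p a\<^sub>1 N"
  obtain K where K: "\<And>s. s \<in> states \<delta> \<Longrightarrow> \<bar>real s * (cycle_cost p (\<pi> s) s - g)\<bar> \<le> K"
    using finite_abs_bound[of "states \<delta>" "\<lambda>s. real s * (cycle_cost p (\<pi> s) s - g)"] by auto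
  \<comment> \<open>A start below \<open>duration p a\<^sub>1\<close> may lead through a state above \<open>N\<close>, hence two levels.\<close>
  define k where "k s = (if s < duration p a\<^sub>1 then 2 * K else if s \<le> N then 0 else K)" for s
  define h where "h s = age_potential g s + k s" for s
  have "reduced_cost p \<delta> g h s (\<pi> s) \<le> 0" if s: "s \<in> states \<delta>" for s
  proof -
    have s0: "s > 0" "s \<le> \<delta>" using s by (auto simp: states_def)
    have K0: "0 \<le> K" using K[OF s] by linarith
    show ?thesis
    proof (cases "\<pi> s = Idle")
      case True
      have "s < N"
        using True threshold_update[of s] s0 update by (metis not_less)
      then have "s < \<delta>" "k (s + 1) \<le> k s" using N_bounds K0 by (auto simp: k_def)
      then show ?thesis using True age_potential_idle[of p s g]
        by (simp add: reduced_cost_def h_def)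
    next
      case a: False
      define L where "L = duration p (\<pi> s)"
      have L: "duration p a\<^sub>1 \<le> L" "L \<le> \<delta>" using duration_update[OF a] \<delta> by (auto simp: L_def)
      have red: "reduced_cost p \<delta> g h s (\<pi> s) =
          real s * (cycle_cost p (\<pi> s) s - g) + k L - k s"
        using a L age_potential_update[OF s0(1), of p "\<pi> s" g]
        by (simp add: reduced_cost_def h_def next_state_update min_absorb1 L_def)
      show ?thesis
      proof (cases "s < duration p a\<^sub>1")
        case True
        \<comment> \<open>The update may be either one; its excess and the level it lands on are at
          most \<open>K\<close> each, covered by the level \<open>2 * K\<close> left behind.\<close>
        have "k L \<le> K" using L K0 by (auto simp: k_def)
        then show ?thesis using red K[OF s] True by (simp add: k_def)
      next
        case False
        then have "N \<le> s" using threshold_idle[of s] a by force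
        then have \<pi>s: "\<pi> s = a\<^sub>1" using threshold_update s0 by blast
        then have "k L = 0" using N_bounds by (simp add: k_def L_def)
        \<comment> \<open>At \<open>N\<close> the excess is zero by the choice of \<open>g\<close>;
          above \<open>N\<close> the drop of \<open>k\<close> from \<open>K\<close> to 0 covers
          it.\<close>
        moreover have "s = N \<or> k s = K" using \<open>N \<le> s\<close> False by (auto simp: k_def)
        moreover have "k s \<ge> 0" using K0 by (simp add: k_def)
        ultimately show ?thesis using red K[OF s] \<pi>s by (auto simp: g_def)
      qed
    qed
  qed
  then show ?thesis unfolding g_def[symmetric] by (rule average_cost_le[OF valid \<mu>])
qed

text \<open>This is the common state for the unichain property. Below it the actions are arbitrary,
  but an idle step raises the age and an update lands at \<open>duration p a\<^sub>1\<close> or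
  above.\<close>

lemma threshold_reaches:
  assumes "s \<in> states \<delta>"
  shows "\<exists>t. state_at p \<delta> \<pi> s t = duration p a\<^sub>1"
proof -
  have step: "\<exists>t. state_at p \<delta> \<pi> s t = c"
    if "\<exists>t. state_at p \<delta> \<pi> (next_state p \<delta> s (\<pi> s)) t = c" for s c
    using that by (metis state_at_Suc_shift)
  have from_above: "\<exists>t. state_at p \<delta> \<pi> s t = duration p a\<^sub>1" if "N \<le> s" "s \<le> \<delta>" for s
  proof (rule step)
    have "next_state p \<delta> s (\<pi> s) = duration p a\<^sub>1"
      using that threshold_update[of s] update N_bounds by (simp add: next_state_update)
    then have "state_at p \<delta> \<pi> (next_state p \<delta> s (\<pi> s)) 0 = duration p a\<^sub>1" by simp
    then show "\<exists>t. state_at p \<delta> \<pi> (next_state p \<delta> s (\<pi> s)) t = duration p a\<^sub>1" ..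
  qed
  have from_relevant: "\<exists>t. state_at p \<delta> \<pi> s t = duration p a\<^sub>1"
    if "duration p a\<^sub>1 \<le> s" "s \<le> \<delta>" for s
    using that
  \<comment> \<open>Truncated subtraction puts all \<open>s \<ge> N\<close> into the base
    case.\<close>
  proof (induction "N - s" arbitrary: s)
    case 0
    then show ?case using from_above by simp
  next
    case (Suc m)
    have "next_state p \<delta> s (\<pi> s) = s + 1"
      using Suc threshold_idle[of s] N_bounds by simp
    moreover have "\<exists>t. state_at p \<delta> \<pi> (s + 1) t = duration p a\<^sub>1"
      using Suc N_bounds by (intro Suc.hyps(1)) auto
    ultimately show ?case using step[of s] by simp
  qed
  have "s \<le> \<delta>" using assms by (simp add: states_def)
  then show ?thesis
  proof (induction "duration p a\<^sub>1 - s" arbitrary: s)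
    case 0
    then show ?case using from_relevant by simp
  next
    case (Suc m)
    show ?case
    proof (rule step, cases "\<pi> s = Idle")
      case True
      then have "next_state p \<delta> s (\<pi> s) = s + 1" using Suc N_bounds by simp
      moreover have "\<exists>t. state_at p \<delta> \<pi> (s + 1) t = duration p a\<^sub>1"
        using Suc N_bounds by (intro Suc.hyps(1)) auto
      ultimately show "\<exists>t. state_at p \<delta> \<pi> (next_state p \<delta> s (\<pi> s)) t = duration p a\<^sub>1" by simp
    next
      case False
      then show "\<exists>t. state_at p \<delta> \<pi> (next_state p \<delta> s (\<pi> s)) t = duration p a\<^sub>1"
        using duration_update[OF False] \<delta>
        by (intro from_relevant) (auto simp: next_state_update)
    qed
  qed
qed

end

text \<open>The lower bound for all policies and the upper bound for the threshold policy meet at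
  the cycle cost of \<open>N\<close>. The cost bound on \<open>\<delta>\<close> uses the cycle at
  \<open>duration p a\<^sub>1\<close>, which is free of \<open>\<Omega>\<close> and by minimality
  costs no less.\<close>

lemma optimal_threshold_if_minimal:
  fixes \<delta> \<Omega> N :: nat
  defines "N \<equiv> max \<Omega> (duration p a\<^sub>1)"
  assumes \<delta>: "duration p a\<^sub>2 \<le> \<delta>" "\<Omega> \<le> \<delta>" "cycle_cost p a\<^sub>1 (duration p a\<^sub>1) \<le> real \<delta>"
    and min: "\<And>n. duration p a\<^sub>1 \<le> n \<Longrightarrow> cycle_cost p a\<^sub>1 N \<le> cycle_cost p a\<^sub>1 n"
  shows "optimal_threshold p \<delta> a\<^sub>1 \<Omega>"
  unfolding optimal_threshold_def optimal_policy_def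
proof (intro allI impI conjI)
  fix \<pi> assume thr: "threshold_policy p \<delta> a\<^sub>1 \<Omega> \<pi>"
  show "unichain p \<delta> \<pi>"
    by (rule unichain_if_common_state[OF threshold_reaches[OF \<delta>(1,2) thr]])
  fix \<pi>' \<mu> assume \<mu>: "set_pmf \<mu> \<subseteq> states \<delta>"
  have "0 < N" using duration_pos[OF valid, of a\<^sub>1] by (simp add: N_def)
  then have "0 \<le> cycle_cost p a\<^sub>1 N" by (rule cycle_cost_nonneg[OF update(1)])
  moreover have "cycle_cost p a\<^sub>1 N \<le> real \<delta>" using min[OF order_refl] \<delta>(3) by linarith
  ultimately have "ereal (cycle_cost p a\<^sub>1 N) \<le> average_cost p \<delta> \<mu> \<pi>'"
    using \<delta>(1) min \<mu> by (intro average_cost_lower_bound) auto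
  then show "average_cost p \<delta> \<mu> \<pi> \<le> average_cost p \<delta> \<mu> \<pi>'"
    using threshold_average_cost[OF \<delta>(1,2) thr \<mu>] unfolding N_def by (rule order_trans[rotated])
qed

end

theorem theorem5:
  fixes p :: update_params and a\<^sub>1 a\<^sub>2 :: action
  assumes "valid_params p"
    and "a\<^sub>1 \<in> {Transmit, Preprocess}" and "a\<^sub>2 \<in> {Transmit, Preprocess}" and "a\<^sub>1 \<noteq> a\<^sub>2"
    and "duration p a\<^sub>1 = min (duration p Transmit) (duration p Preprocess)"
    and "duration p a\<^sub>2 = max (duration p Transmit) (duration p Preprocess)"
    and "energy p a\<^sub>1 / real (duration p a\<^sub>1) \<le> energy p a\<^sub>2 / real (duration p a\<^sub>2)"
  shows "\<forall>\<^sub>F \<delta> in sequentially. \<forall>\<Omega>.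
           is_arg_min (J p a\<^sub>1)
             (\<lambda>n. n \<in> {nat \<lfloor>sqrt (2 * weight p * energy p a\<^sub>1)\<rfloor>,
                       nat \<lceil>sqrt (2 * weight p * energy p a\<^sub>1)\<rceil>}) \<Omega>
           \<longrightarrow> optimal_threshold p \<delta> a\<^sub>1 \<Omega>"
proof -
  interpret ordered_updates p a\<^sub>1 a\<^sub>2
  proof
    show "a = Idle \<or> a = a\<^sub>1 \<or> a = a\<^sub>2" for a using assms(2-4) by (cases a) auto
    show "relevant_states p \<delta> = {duration p a\<^sub>1..\<delta>}" for \<delta>
      using assms(5) by (simp add: relevant_states_def)
  qed (use assms in auto)
  define lo hi where "lo = nat \<lfloor>sqrt (2 * weight p * energy p a\<^sub>1)\<rfloor>"
    and "hi = nat \<lceil>sqrt (2 * weight p * energy p a\<^sub>1)\<rceil>"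
  \<comment> \<open>All demands on \<open>\<delta>\<close>: room for both candidates and the longer
    update, and the cost bound. One \<open>D\<close> serves every \<open>\<Omega>\<close>.\<close>
  define D where "D = max (max lo hi)
    (max (duration p a\<^sub>2) (nat \<lceil>cycle_cost p a\<^sub>1 (duration p a\<^sub>1)\<rceil>))"
  have "optimal_threshold p \<delta> a\<^sub>1 \<Omega>"
    if \<delta>: "D \<le> \<delta>" and arg: "is_arg_min (J p a\<^sub>1) (\<lambda>n. n \<in> {lo, hi}) \<Omega>" for \<delta> \<Omega>
  proof (rule optimal_threshold_if_minimal)
    show "duration p a\<^sub>2 \<le> \<delta>" "\<Omega> \<le> \<delta>"
      using \<delta> arg by (auto simp: D_def is_arg_min_def)
    show "cycle_cost p a\<^sub>1 (duration p a\<^sub>1) \<le> real \<delta>"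
      using \<delta> by (simp add: D_def)
    show "cycle_cost p a\<^sub>1 (max \<Omega> (duration p a\<^sub>1)) \<le> cycle_cost p a\<^sub>1 n"
      if "duration p a\<^sub>1 \<le> n" for n
      using duration_pos[OF valid, of a\<^sub>1] that arg
      by (intro cycle_cost_minimum[OF valid update(1)]) (auto simp: lo_def hi_def)
  qed
  then show ?thesis
    unfolding eventually_sequentially lo_def hi_def by blast
qed

end
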